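(* For every integer $n\ge1$ and every function $f\in\mathcal{T}$ with Taylor expansion $f(z)=z+\sum_{k=2}^{\infty}a_kz^k$ (and $a_1=1$), we have $-(n+1)^2\le T_2(n)\le n^2$, where $T_2(n)=a_n^2-a_{n+1}^2$. In particular: (i) if $n$ is odd, then $\max\{T_2(n):f\in\mathcal{T}\}=n^2$, and the maximum is attained for the function $F(z,1/2,1,-1)$; (ii) if $n$ is even, then $\min\{T_2(n):f\in\mathcal{T}\}=-(n+1)^2$, and the minimum is attained for the function $F(z,1/2,1,-1)$.
   Context: $\mathbb{D}=\{z\in\mathbb{C}:|z|<1\}$. $\mathcal{T}$ is the class of typically real functions: analytic functions $f$ in $\mathbb{D}$, normalized by $f(z)=z+\sum_{n=2}^\infty a_nz^n$, with $(\operatorname{Im} z)(\operatorname{Im} f(z))\ge0$ for $z\in\mathbb{D}$. By a theorem of Robertson, $f\in\mathcal{T}$ if and only if $f(z)=\int_{-1}^1k(z,t)\,d\mu(t)$ for some probability measure $\mu$ on $[-1,1]$, where $k(z,t)=\frac{z}{1-2tz+z^2}$. In particular all coefficients $a_n$ are real. For $0\le\alpha\le1$ and $t_1,t_2\in[-1,1]$, $F(z,\alpha,t_1,t_2)=\alpha k(z,t_1)+(1-\alpha)k(z,t_2)$. *)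

theory Defs
  imports "HOL-Complex_Analysis.Complex_Analysis"
begin

definition typically_real :: "(complex \<Rightarrow> complex) set" where
  "typically_real =
     {f. f holomorphic_on ball 0 1 \<and> f 0 = 0 \<and> deriv f 0 = 1 \<and>
         (\<forall>z\<in>ball 0 1. Im z * Im (f z) \<ge> 0)}"

definition taylor_coeff :: "(complex \<Rightarrow> complex) \<Rightarrow> nat \<Rightarrow> complex" where
  "taylor_coeff f n = fps_nth (fps_expansion f 0) n"

text \<open>
  The real part in the next definition only serves to obtain a value of type \<^typ>\<open>real\<close>:
  the Taylor coefficients of a typically real function are real numbers, see
  \<open>taylor_coeff_typically_real_in_Reals\<close> below.
\<close>

definition T2 :: "(complex \<Rightarrow> complex) \<Rightarrow> nat \<Rightarrow> real" where
  "T2 f n = Re ((taylor_coeff f n)\<^sup>2 - (taylor_coeff f (n + 1))\<^sup>2)"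

definition robertson_kernel :: "complex \<Rightarrow> real \<Rightarrow> complex" where
  "robertson_kernel z t = z / (1 - 2 * of_real t * z + z\<^sup>2)"

definition robertson_F :: "complex \<Rightarrow> real \<Rightarrow> real \<Rightarrow> real \<Rightarrow> complex" where
  "robertson_F z \<alpha> t1 t2 =
     of_real \<alpha> * robertson_kernel z t1 + of_real (1 - \<alpha>) * robertson_kernel z t2"

lemma typically_real_on_real_axis:
  assumes f: "f \<in> typically_real" and x: "\<bar>x\<bar> < 1"
  shows "Im (f (of_real x)) = 0"
proof -
  have hol: "f holomorphic_on ball 0 1"
    and pos: "\<And>z. z \<in> ball 0 1 \<Longrightarrow> Im z * Im (f z) \<ge> 0"
    using f by (auto simp: typically_real_def)
  have xb: "complex_of_real x \<in> ball 0 1"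
    using x by simp
  have cont: "isCont f (of_real x)"
    using hol xb holomorphic_on_imp_continuous_on continuous_on_eq_continuous_at open_ball by blast
  have lim: "((\<lambda>h. of_real x + \<i> * of_real h) \<longlongrightarrow> of_real x) (at (0::real))"
    by (auto intro!: tendsto_eq_intros)
  have limf: "((\<lambda>h. Im (f (of_real x + \<i> * of_real h))) \<longlongrightarrow> Im (f (of_real x))) (at (0::real))"
    by (intro tendsto_Im isCont_tendsto_compose[OF cont lim])
  have ev: "eventually (\<lambda>h. of_real x + \<i> * of_real h \<in> ball 0 1) (at (0::real))"
    using topological_tendstoD[OF lim open_ball xb] .
  have "Im (f (of_real x)) \<ge> 0"
  proof (rule tendsto_lowerbound)
    show "((\<lambda>h. Im (f (of_real x + \<i> * of_real h))) \<longlongrightarrow> Im (f (of_real x))) (at_right (0::real))"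
      using limf by (rule tendsto_mono[rotated]) (simp add: at_le)
    have "eventually (\<lambda>h. of_real x + \<i> * of_real h \<in> ball 0 1) (at_right (0::real))"
      using ev by (rule filter_leD[rotated]) (simp add: at_le)
    then show "eventually (\<lambda>h. 0 \<le> Im (f (of_real x + \<i> * of_real h))) (at_right (0::real))"
      using eventually_at_right_less[of "0::real"]
    proof eventually_elim
      case (elim h)
      then show ?case using pos[of "of_real x + \<i> * of_real h"] by (simp add: zero_le_mult_iff)
    qed
  qed simp
  moreover have "Im (f (of_real x)) \<le> 0"
  proof (rule tendsto_upperbound)
    show "((\<lambda>h. Im (f (of_real x + \<i> * of_real h))) \<longlongrightarrow> Im (f (of_real x))) (at_left (0::real))"
      using limf by (rule tendsto_mono[rotated]) (simp add: at_le)
    have "eventually (\<lambda>h. of_real x + \<i> * of_real h \<in> ball 0 1) (at_left (0::real))"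
      using ev by (rule filter_leD[rotated]) (simp add: at_le)
    moreover have "eventually (\<lambda>h::real. h < 0) (at_left 0)"
      by (simp add: eventually_at_filter)
    ultimately show "eventually (\<lambda>h. Im (f (of_real x + \<i> * of_real h)) \<le> 0) (at_left (0::real))"
    proof eventually_elim
      case (elim h)
      then show ?case using pos[of "of_real x + \<i> * of_real h"] by (simp add: zero_le_mult_iff)
    qed
  qed simp
  ultimately show ?thesis by simp
qed

lemma deriv_on_real_axis:
  assumes hol: "g holomorphic_on ball 0 1"
    and re: "\<And>x::real. \<bar>x\<bar> < 1 \<Longrightarrow> Im (g (of_real x)) = 0" and x: "\<bar>x\<bar> < 1"
  shows "Im (deriv g (of_real x)) = 0"
proof -
  have "(g has_field_derivative deriv g (of_real x)) (at (of_real x))"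
    using hol x by (intro holomorphic_derivI[of _ "ball 0 1"]) auto
  then have lim: "((\<lambda>h. (g (of_real x + h) - g (of_real x)) / h) \<longlongrightarrow> deriv g (of_real x)) (at 0)"
    by (simp add: DERIV_def)
  have "filterlim complex_of_real (at 0) (at (0::real))"
    by (auto simp: filterlim_at eventually_at_filter intro!: tendsto_eq_intros)
  from filterlim_compose[OF lim this]
  have limr: "((\<lambda>h::real. Im ((g (of_real x + of_real h) - g (of_real x)) / of_real h))
          \<longlongrightarrow> Im (deriv g (of_real x))) (at 0)"
    by (rule tendsto_Im)
  have "((\<lambda>h::real. x + h) \<longlongrightarrow> x) (at 0)"
    by (auto intro!: tendsto_eq_intros)
  from topological_tendstoD[OF this, of "{-1<..<1}"]
  have "eventually (\<lambda>h::real. \<bar>x + h\<bar> < 1) (at 0)"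
    using x by (auto simp: abs_less_iff elim!: eventually_mono)
  then have "eventually (\<lambda>h::real.
      Im ((g (of_real x + of_real h) - g (of_real x)) / of_real h) = 0) (at 0)"
  proof eventually_elim
    case (elim h)
    then show ?case using re[of "x + h"] re[OF x] by (simp add: Im_divide_of_real)
  qed
  with limr have "((\<lambda>h::real. 0) \<longlongrightarrow> Im (deriv g (of_real x))) (at (0::real))"
    by (rule Lim_transform_eventually)
  then show ?thesis by (simp add: tendsto_const_iff)
qed

lemma taylor_coeff_typically_real_in_Reals:
  assumes f: "f \<in> typically_real"
  shows "taylor_coeff f n \<in> \<real>"
proof -
  have hol: "(deriv ^^ k) f holomorphic_on ball 0 1" for k
    using f by (intro holomorphic_higher_deriv) (auto simp: typically_real_def)
  have "\<bar>x\<bar> < 1 \<Longrightarrow> Im ((deriv ^^ n) f (of_real x)) = 0" for x :: real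
  proof (induction n arbitrary: x)
    case 0
    then show ?case using typically_real_on_real_axis[OF f] by simp
  next
    case (Suc n)
    then show ?case using deriv_on_real_axis[OF hol] by simp
  qed
  from this[of 0] have "(deriv ^^ n) f 0 \<in> \<real>"
    by (simp add: complex_is_Real_iff)
  moreover have "(fact n :: complex) \<in> \<real>"
    by (metis Reals_of_nat of_nat_fact)
  ultimately show ?thesis
    by (simp add: taylor_coeff_def fps_expansion_def Reals_divide)
qed

end

theory Submission
  imports Defs
begin

text \<open>
  For \<open>0 < r < 1\<close> Cauchy's formula gives
  \<open>\<pi> a\<^sub>n r\<^sup>n = \<integral> Im f(r e\<^bsup>it\<^esup>) sin(nt) dt\<close> over a full period. Typical reality says that
  \<open>Im f(r e\<^bsup>it\<^esup>)\<close> and \<open>sin t\<close> have the same sign, so \<open>\<bar>sin(nt)\<bar> \<le> n \<bar>sin t\<bar>\<close> bounds this integral by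
  \<open>n\<close> times the one for the first coefficient. Hence \<open>\<bar>a\<^sub>n\<bar> r\<^sup>n \<le> n r\<close>, and \<open>\<bar>a\<^sub>n\<bar> \<le> n\<close> as \<open>r\<close> tends to 1.
  The extremal function has coefficients \<open>n\<close> for odd \<open>n\<close> and \<open>0\<close> for even \<open>n\<close>.
\<close>

lemma abs_sin_of_nat_mult_le: "\<bar>sin (real n * x)\<bar> \<le> real n * \<bar>sin x\<bar>"
proof (induction n)
  case (Suc n)
  have "sin (real (Suc n) * x) = sin (real n * x) * cos x + cos (real n * x) * sin x"
    by (simp add: algebra_simps sin_add)
  also have "\<bar>\<dots>\<bar> \<le> \<bar>sin (real n * x)\<bar> * \<bar>cos x\<bar> + \<bar>cos (real n * x)\<bar> * \<bar>sin x\<bar>"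
    by (metis abs_mult abs_triangle_ineq)
  also have "\<dots> \<le> \<bar>sin (real n * x)\<bar> * 1 + 1 * \<bar>sin x\<bar>"
    by (intro add_mono mult_left_mono mult_right_mono) auto
  finally show ?case using Suc by (simp add: algebra_simps)
qed simp

text \<open>Cauchy's formula for the \<open>n\<close>-th derivative integrates \<open>f\<close>
  against \<open>exp(-int)\<close>, and Cauchy's theorem says that \<open>f\<close> against
  \<open>exp(int)\<close> integrates to 0. Half the difference of the two leaves the sine.\<close>

lemma has_integral_sin_coeff:
  assumes hol: "f holomorphic_on ball 0 1" and r: "0 < r" "r < 1" and n: "n \<ge> 1"
  shows "((\<lambda>t. f (of_real r * cis t) * of_real (sin (real n * t))) has_integral
           \<i> * pi * taylor_coeff f n * of_real r ^ n) {0..2*pi}"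
proof -
  have sub: "cball 0 r \<subseteq> ball (0::complex) 1"
    using r by auto
  have "((\<lambda>u. f u / (u - 0) ^ Suc n) has_contour_integral
          (2 * pi * \<i>) / fact n * (deriv ^^ n) f 0) (circlepath 0 r)"
  proof (rule Cauchy_has_contour_integral_higher_derivative_circlepath)
    show "continuous_on (cball 0 r) f"
      using hol sub by (meson holomorphic_on_imp_continuous_on holomorphic_on_subset)
    show "f holomorphic_on ball 0 r"
      using hol r by (meson holomorphic_on_subset less_imp_le subset_ball)
  qed (use r in auto)
  then have neg: "((\<lambda>t. f (of_real r * cis t) / (of_real r * cis t) ^ Suc n * of_real r * \<i> * cis t)
      has_integral 2 * pi * \<i> * taylor_coeff f n) {0..2*pi}"
    by (simp add: circlepath_def has_contour_integral_part_circlepath_iff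
          taylor_coeff_def fps_expansion_def mult_ac)
  \<comment> \<open>On the circle du = i u dt supplies one more factor u, so the exponent
    \<open>n - 1\<close> produces \<open>u ^ n\<close>. As \<open>n\<close> is positive, there is no
    pole at 0.\<close>
  have "((\<lambda>u. f u * u ^ (n - 1)) has_contour_integral 0) (circlepath 0 r)"
  proof (rule Cauchy_theorem_convex_simple)
    show "(\<lambda>u. f u * u ^ (n - 1)) holomorphic_on ball 0 1"
      using hol by (intro holomorphic_intros)
  qed (use r in auto)
  then have pos: "((\<lambda>t. f (of_real r * cis t) * (of_real r * cis t) ^ (n - 1) * of_real r * \<i> * cis t)
      has_integral 0) {0..2*pi}"
    by (simp add: circlepath_def has_contour_integral_part_circlepath_iff)
  \<comment> \<open>The factors \<open>r ^ n\<close> and \<open>1 / r ^ n\<close> cancel the moduli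
    of \<open>u ^ (-n)\<close> and \<open>u ^ n\<close>, so that only the unimodular exponentials
    remain.\<close>
  have "((\<lambda>t. 1 / 2 *
       (of_real r ^ n * (f (of_real r * cis t) / (of_real r * cis t) ^ Suc n * of_real r * \<i> * cis t) -
        1 / of_real r ^ n *
          (f (of_real r * cis t) * (of_real r * cis t) ^ (n - 1) * of_real r * \<i> * cis t)))
      has_integral 1 / 2 * (of_real r ^ n * (2 * pi * \<i> * taylor_coeff f n) - 1 / of_real r ^ n * 0))
        {0..2*pi}"
    by (intro has_integral_mult_right has_integral_mult_left has_integral_diff neg pos)
  also have "1 / 2 * (of_real r ^ n * (2 * pi * \<i> * taylor_coeff f n) - 1 / of_real r ^ n * 0) =
      \<i> * pi * taylor_coeff f n * of_real r ^ n"
    by (simp add: mult_ac)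
  finally show ?thesis
  proof (rule has_integral_eq[rotated])
    fix t :: real
    obtain m where m: "n = Suc m"
      using n by (cases n) auto
    have c: "cis t ^ n = cos (n * t) + \<i> * sin (n * t)"
      unfolding Complex.DeMoivre by (simp add: complex_eq_iff)
    have c': "1 / cis t ^ n = cos (n * t) - \<i> * sin (n * t)"
      unfolding Complex.DeMoivre by (simp add: complex_eq_iff divide_inverse)
    have neg_eq: "of_real r ^ n * (f (of_real r * cis t) / (of_real r * cis t) ^ Suc n * of_real r * \<i> * cis t)
        = f (of_real r * cis t) * \<i> * (cos (n * t) - \<i> * sin (n * t))"
      unfolding c'[symmetric] using r by (simp add: power_mult_distrib field_simps)
    have pos_eq: "1 / of_real r ^ n *
        (f (of_real r * cis t) * (of_real r * cis t) ^ (n - 1) * of_real r * \<i> * cis t) =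
        f (of_real r * cis t) * \<i> * (cos (n * t) + \<i> * sin (n * t))"
      unfolding c[symmetric] using r by (simp add: m power_mult_distrib field_simps)
    show "1 / 2 *
       (of_real r ^ n * (f (of_real r * cis t) / (of_real r * cis t) ^ Suc n * of_real r * \<i> * cis t) -
        1 / of_real r ^ n *
          (f (of_real r * cis t) * (of_real r * cis t) ^ (n - 1) * of_real r * \<i> * cis t)) =
       f (of_real r * cis t) * of_real (sin (real n * t))"
      unfolding neg_eq pos_eq by (simp add: algebra_simps)
  qed
qed

lemma typically_real_coeff_bound:
  assumes f: "f \<in> typically_real" and n: "n \<ge> 1"
  shows "\<bar>Re (taylor_coeff f n)\<bar> \<le> real n"
proof -
  have hol: "f holomorphic_on ball 0 1" and d: "deriv f 0 = 1"
    and sgn: "\<And>z. z \<in> ball 0 1 \<Longrightarrow> Im z * Im (f z) \<ge> 0"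
    using f by (auto simp: typically_real_def)
  have one: "taylor_coeff f 1 = 1"
    using d by (simp add: taylor_coeff_def fps_expansion_def)
  \<comment> \<open>The sine is real, so taking imaginary parts acts on \<open>f\<close> alone; on
    the right, the factor i turns Im into \<open>Re (taylor_coeff f k)\<close>.\<close>
  have I: "((\<lambda>t. Im (f (of_real r * cis t)) * sin (real k * t)) has_integral
           pi * Re (taylor_coeff f k) * r ^ k) {0..2*pi}" if "0 < r" "r < 1" "k \<ge> 1" for r k
    using has_integral_linear[OF has_integral_sin_coeff[OF hol that] bounded_linear_Im]
    by (simp add: o_def flip: of_real_power)
  have bound: "\<bar>Re (taylor_coeff f n)\<bar> * r ^ n \<le> real n * r" if r: "0 < r" "r < 1" for r
  proof -
    \<comment> \<open>The right-hand side needs no absolute value, since Im z = r sin t has the sign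
      of Im f(z). Writing \<open>real 1 * t\<close> makes it the integrand of \<open>I\<close> for
      \<open>k = 1\<close>.\<close>
    have le: "\<bar>Im (f (of_real r * cis t)) * sin (real n * t)\<bar>
        \<le> real n * (Im (f (of_real r * cis t)) * sin (real 1 * t))" for t
    proof -
      have "r * (sin t * Im (f (of_real r * cis t))) \<ge> 0"
        using sgn[of "of_real r * cis t"] r by (simp add: norm_mult mult_ac)
      then have "Im (f (of_real r * cis t)) * sin t \<ge> 0"
        using r by (simp add: zero_le_mult_iff mult.commute)
      then have "\<bar>Im (f (of_real r * cis t))\<bar> * \<bar>sin t\<bar> = Im (f (of_real r * cis t)) * sin t"
        by (simp flip: abs_mult)
      moreover have "\<bar>Im (f (of_real r * cis t))\<bar> * \<bar>sin (real n * t)\<bar> \<le>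
          \<bar>Im (f (of_real r * cis t))\<bar> * (real n * \<bar>sin t\<bar>)"
        by (intro mult_left_mono abs_sin_of_nat_mult_le) auto
      ultimately show ?thesis by (simp add: abs_mult mult_ac)
    qed
    \<comment> \<open>The normalization a_1 = 1 gives this integral its explicit value.\<close>
    have up: "((\<lambda>t. real n * (Im (f (of_real r * cis t)) * sin (real 1 * t))) has_integral
        real n * (pi * r)) {0..2*pi}"
      using has_integral_mult_right[OF I[OF r, of 1], of "real n"] one by simp
    have "pi * Re (taylor_coeff f n) * r ^ n \<le> real n * (pi * r)"
      by (rule has_integral_le[OF I[OF r n] up]) (use le in \<open>simp add: abs_le_iff\<close>)
    moreover have "- (pi * Re (taylor_coeff f n) * r ^ n) \<le> real n * (pi * r)"
      by (rule has_integral_le[OF has_integral_neg[OF I[OF r n]] up])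
        (use le in \<open>simp add: abs_le_iff\<close>)
    ultimately have "pi * (Re (taylor_coeff f n) * r ^ n) \<le> pi * (real n * r)"
      "pi * (- (Re (taylor_coeff f n) * r ^ n)) \<le> pi * (real n * r)"
      by (simp_all add: mult_ac)
    then have "\<bar>Re (taylor_coeff f n) * r ^ n\<bar> \<le> real n * r"
      unfolding abs_le_iff using mult_left_le_imp_le pi_gt_zero by blast
    then show ?thesis
      using r by (simp add: abs_mult)
  qed
  have lim: "((\<lambda>r. \<bar>Re (taylor_coeff f n)\<bar> * r ^ n) \<longlongrightarrow> \<bar>Re (taylor_coeff f n)\<bar> * 1 ^ n) (at_left 1)"
    "((\<lambda>r. real n * r) \<longlongrightarrow> real n * 1) (at_left 1)"
    by (intro tendsto_intros)+
  have ev: "eventually (\<lambda>r::real. r \<in> {0<..<1}) (at_left 1)"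
    by (rule eventually_at_leftI[of 0]) auto
  have "\<bar>Re (taylor_coeff f n)\<bar> * 1 ^ n \<le> real n * 1"
    by (rule tendsto_le[OF _ lim(2,1)])
      (use ev bound in \<open>auto elim!: eventually_mono\<close>)
  then show ?thesis by simp
qed

text \<open>At t = 1 and t = -1 the denominator of the kernel is a perfect square. The result is the
  odd part of the Koebe function k(z) = z / (1 - z)^2, because z / (1 + z)^2 = -k(-z).\<close>

lemma robertson_F_half_eq:
  "robertson_F z (1/2) 1 (-1) = (z / (1 - z)\<^sup>2 + z / (1 + z)\<^sup>2) / 2"
  by (simp add: robertson_F_def robertson_kernel_def power2_eq_square algebra_simps
        add_divide_distrib)

lemma sums_koebe:
  assumes "norm (z::complex) < 1"
  shows "(\<lambda>n. of_nat n * z ^ n) sums (z / (1 - z)\<^sup>2)"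
proof -
  have "(\<lambda>n. z * (of_nat (Suc n) * z ^ n)) sums (z * (1 / (1 - z)\<^sup>2))"
    using assms by (intro sums_mult geometric_deriv_sums)
  then have "(\<lambda>n. of_nat (Suc n) * z ^ Suc n) sums (z / (1 - z)\<^sup>2)"
    by (simp add: mult_ac)
  then show ?thesis
    \<comment> \<open>The index shift adds only the term for n = 0, which vanishes.\<close>
    by (subst (asm) sums_Suc_iff) simp
qed

text \<open>Passing to the odd part of the Koebe series removes the even powers and keeps the odd
  ones; uniqueness of the power series expansion then identifies the coefficients.\<close>

lemma taylor_coeff_robertson_F_half:
  "taylor_coeff (\<lambda>z. robertson_F z (1/2) 1 (-1)) n = (if odd n then of_nat n else 0)"
proof -
  define G where "G = Abs_fps (\<lambda>n. if odd n then of_nat n else (0::complex))"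
  have "(\<lambda>n. fps_nth G n * z ^ n) sums robertson_F z (1/2) 1 (-1)" if "z \<in> ball 0 1" for z
  proof -
    have "(\<lambda>n. (of_nat n * z ^ n - of_nat n * (-z) ^ n) / 2) sums
        ((z / (1 - z)\<^sup>2 - (-z) / (1 - (-z))\<^sup>2) / 2)"
      using that by (intro sums_divide sums_diff sums_koebe) auto
    also have "(\<lambda>n. (of_nat n * z ^ n - of_nat n * (-z) ^ n) / 2) = (\<lambda>n. fps_nth G n * z ^ n)"
      by (rule ext) (auto simp: G_def)
    finally show ?thesis
      by (simp add: robertson_F_half_eq)
  qed
  then have "(\<lambda>z. robertson_F z (1/2) 1 (-1)) has_fps_expansion G"
    by (intro has_fps_expansionI eventually_mono[OF eventually_nhds_in_open[of "ball 0 1"]]) auto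
  then have "fps_expansion (\<lambda>z. robertson_F z (1/2) 1 (-1)) 0 = G"
    by (rule fps_expansion_eqI)
  then show ?thesis
    by (simp add: taylor_coeff_def G_def)
qed

lemma Im_mult_Im_koebe_nonneg:
  assumes "norm z < 1"
  shows "Im z * Im (z / (1 - z)\<^sup>2) \<ge> 0"
proof -
  have "z / (1 - z)\<^sup>2 = z * cnj ((1 - z)\<^sup>2) / (norm ((1 - z)\<^sup>2))\<^sup>2"
    by (rule complex_div_cnj)
  then have "Im (z / (1 - z)\<^sup>2) = Im (z * cnj ((1 - z)\<^sup>2)) / (norm ((1 - z)\<^sup>2))\<^sup>2"
    by (metis Im_divide_of_real of_real_power)
  \<comment> \<open>Expanding gives z - 2 |z|^2 + |z|^2 cnj(z), and the middle term is real.\<close>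
  also have "Im (z * cnj ((1 - z)\<^sup>2)) = Im z * (1 - (norm z)\<^sup>2)"
    unfolding cmod_power2 by (simp add: power2_eq_square algebra_simps)
  finally have "Im z * Im (z / (1 - z)\<^sup>2) =
      (Im z)\<^sup>2 * (1 - (norm z)\<^sup>2) / (norm ((1 - z)\<^sup>2))\<^sup>2"
    by (simp add: power2_eq_square)
  moreover have "(norm z)\<^sup>2 \<le> 1"
    using assms by (simp add: power_le_one)
  ultimately show ?thesis by simp
qed

lemma robertson_F_half_typically_real:
  "(\<lambda>z. robertson_F z (1/2) 1 (-1)) \<in> typically_real"
proof -
  have nz: "1 - z \<noteq> 0" "1 + z \<noteq> 0" if "z \<in> ball 0 1" for z :: complex
    using that by (auto simp: add_eq_0_iff)
  have "(\<lambda>z. robertson_F z (1/2) 1 (-1)) holomorphic_on ball 0 1"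
    unfolding robertson_F_half_eq by (intro holomorphic_intros) (use nz in auto)
  moreover have "deriv (\<lambda>z. robertson_F z (1/2) 1 (-1)) 0 = 1"
    using taylor_coeff_robertson_F_half[of 1] by (simp add: taylor_coeff_def fps_expansion_def)
  moreover have "Im z * Im (robertson_F z (1/2) 1 (-1)) \<ge> 0" if "z \<in> ball 0 1" for z
  proof -
    \<comment> \<open>The second summand is -k(-z) for the Koebe function k, so replacing z by -z
      changes both signs and the product is preserved.\<close>
    have "Im z * Im (z / (1 - z)\<^sup>2) \<ge> 0" "Im z * Im (z / (1 + z)\<^sup>2) \<ge> 0"
      using that Im_mult_Im_koebe_nonneg[of z] Im_mult_Im_koebe_nonneg[of "-z"] by auto
    moreover have "Im z * Im (robertson_F z (1/2) 1 (-1)) =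
        (Im z * Im (z / (1 - z)\<^sup>2) + Im z * Im (z / (1 + z)\<^sup>2)) / 2"
      unfolding robertson_F_half_eq by (simp add: distrib_left del: Im_divide)
    ultimately show ?thesis by simp
  qed
  ultimately show ?thesis
    by (simp add: typically_real_def robertson_F_half_eq)
qed

lemma T2_bounds:
  assumes f: "f \<in> typically_real" and n: "n \<ge> 1"
  shows "- ((real n + 1)\<^sup>2) \<le> T2 f n \<and> T2 f n \<le> (real n)\<^sup>2"
proof -
  \<comment> \<open>Since the coefficients are real, Re of the square is the square of Re. Each
    bound then discards one of the two nonnegative squares.\<close>
  have "T2 f n = (Re (taylor_coeff f n))\<^sup>2 - (Re (taylor_coeff f (n + 1)))\<^sup>2"
    using taylor_coeff_typically_real_in_Reals[OF f]
    by (simp add: T2_def complex_is_Real_iff power2_eq_square)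
  moreover have "(Re (taylor_coeff f n))\<^sup>2 \<le> (real n)\<^sup>2"
    using typically_real_coeff_bound[OF f n] by (simp flip: abs_le_square_iff)
  moreover have "(Re (taylor_coeff f (n + 1)))\<^sup>2 \<le> (real n + 1)\<^sup>2"
    using typically_real_coeff_bound[OF f, of "n + 1"] by (simp flip: abs_le_square_iff)
  moreover have "0 \<le> (Re (taylor_coeff f n))\<^sup>2" "0 \<le> (Re (taylor_coeff f (n + 1)))\<^sup>2"
    by simp_all
  ultimately show ?thesis by linarith
qed

theorem theorem2p7:
  fixes n :: nat
  assumes "n \<ge> 1"
  shows "(\<forall>f\<in>typically_real. - ((real n + 1)\<^sup>2) \<le> T2 f n \<and> T2 f n \<le> (real n)\<^sup>2) \<and>
    (odd n \<longrightarrow>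
       is_arg_max (\<lambda>f. T2 f n) (\<lambda>f. f \<in> typically_real) (\<lambda>z. robertson_F z (1/2) 1 (-1)) \<and>
       T2 (\<lambda>z. robertson_F z (1/2) 1 (-1)) n = (real n)\<^sup>2) \<and>
    (even n \<longrightarrow>
       is_arg_min (\<lambda>f. T2 f n) (\<lambda>f. f \<in> typically_real) (\<lambda>z. robertson_F z (1/2) 1 (-1)) \<and>
       T2 (\<lambda>z. robertson_F z (1/2) 1 (-1)) n = - ((real n + 1)\<^sup>2))"
proof -
  \<comment> \<open>Exactly one of \<open>n\<close> and \<open>n + 1\<close> is odd; its coefficient
    is as large as possible while the other one is 0, and parity decides which bound is
    attained.\<close>
  have T2_F: "T2 (\<lambda>z. robertson_F z (1/2) 1 (-1)) n =
      (if odd n then (real n)\<^sup>2 else - ((real n + 1)\<^sup>2))"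
    by (simp add: T2_def taylor_coeff_robertson_F_half power2_eq_square add.commute)
  have "\<forall>f\<in>typically_real. - ((real n + 1)\<^sup>2) \<le> T2 f n \<and> T2 f n \<le> (real n)\<^sup>2"
    using T2_bounds assms by blast
  then show ?thesis
    using T2_F robertson_F_half_typically_real
    by (auto simp: is_arg_max_def is_arg_min_def not_less)
qed

end
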